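(* Let $\mathcal{A}$ be the algebra of (generally square-matrix-valued) functions $F[u]$ on the jet space described in the context, with total derivatives $D_i$. Let $\Delta_1$ and $\Delta_2$ be characteristic derivatives with characteristics $Q_1[u],Q_2[u]\in\mathcal{A}$, respectively, so that $\Delta_1u=Q_1[u]$ and $\Delta_2u=Q_2[u]$. Define the operator $[\Delta_1,\Delta_2]$ (Lie bracket) on $\mathcal{A}$ by $[\Delta_1,\Delta_2]F[u]:=\Delta_1(\Delta_2F[u])-\Delta_2(\Delta_1F[u])$. Then $[\Delta_1,\Delta_2]$ is a characteristic derivative with characteristic $\Delta_1Q_2[u]-\Delta_2Q_1[u]$; that is, $[\Delta_1,\Delta_2]=\Delta_Q$ with $Q[u]=\Delta_1Q_2[u]-\Delta_2Q_1[u]$.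
   Context: Jet-space functions. Let $x^1,x^2,\ldots$ be scalar independent variables (collectively $x^k$), and let $u$ be a dependent variable, together with its formal partial derivatives $u_i$, $u_{ij}$, $u_{ijk},\ldots$ (symmetric in their indices). All of these are square-matrix-valued of one fixed size, in general non-commuting, with entries in $\mathbb{K}=\mathbb{R}$ or $\mathbb{C}$; the scalar case is size $1$. $\mathcal{A}$ is the (generally non-commutative) associative $\mathbb{K}$-algebra of functions of the form $F[u]=\sum a(x^k)\,\Pi[u]\,b(x^k)\,\Pi'[u]\,c(x^k)\cdots$, a finite or infinite sum, where $a,b,c,\ldots$ are (generally matrix-valued) functions of the $x^k$ only ("functions in the base space") and $\Pi[u],\Pi'[u],\ldots$ are products of powers of the variables $u,u_i,u_{ij},\ldots$. Total derivatives. $D_i$ is the linear operator on $\mathcal{A}$ such that $D_i f(x^k)=\partial f/\partial x^i$ for base-space functions $f$; $D_i u=u_i$, $D_i u_j=D_j u_i=u_{ij}=u_{ji}$, and so on for higher derivatives; and $D_i(FG)=(D_iF)G+F\,D_iG$ for all $F,G\in\mathcal{A}$. Total derivatives commute with each other. Characteristic derivatives. For $Q[u]\in\mathcal{A}$, a characteristic derivative with characteristic $Q[u]$ is a linear operator $\Delta_Q:\mathcal{A}\to\mathcal{A}$ such that: (1) $\Delta_Q f(x^k)=0$ for every base-space function $f$; (2) $\Delta_Q u=Q[u]$; (3) $\Delta_Q D_i=D_i\Delta_Q$ for all $i$; (4) $\Delta_Q(FG)=(\Delta_QF)G+F\,\Delta_QG$ for all $F,G\in\mathcal{A}$. Standing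 convention: $\Delta_Q$ is uniquely determined by its action on $u$, i.e. by $Q$ (operators act term by term on the sums defining $\mathcal{A}$). *)

theory Defs
  imports "HOL-Analysis.Analysis" "HOL-Library.Function_Algebras" "HOL-Library.Multiset"
begin

text \<open>
  Conventions. The independent variables are real and indexed by an arbitrary type \<open>'d\<close>, so a
  point of the base space is a function \<open>'d \<Rightarrow> real\<close>; base-space functions are smooth on
  a fixed open set \<open>X\<close>. By the Gelfand--Mazur theorem, the class \<open>real_normed_field\<close> consists,
  up to isomorphism, exactly of the real and the complex numbers, so it is the constraint on the
  field \<open>'k\<close> of matrix entries. Products of matrices are written \<open>**\<close>; the
  operation \<open>*\<close> of the library on \<open>'k^'n^'n\<close> is entrywise and is never used here.
\<close>

text \<open>
  A jet is a pair \<open>(x, v)\<close> of a base point and values \<open>v I\<close> of the variables \<open>u\<^sub>I\<close>. Since these are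
  symmetric in their indices, \<open>I\<close> is a multiset; \<open>v {#}\<close> is the value of \<open>u\<close> itself.
\<close>

type_synonym ('k, 'n, 'd) jet = "('d \<Rightarrow> real) \<times> ('d multiset \<Rightarrow> 'k^'n^'n)"

text \<open>
  An element \<open>F[u]\<close> is a finite or infinite sum of terms, each of which is homogeneous in the
  variables \<open>u\<^sub>I\<close>. It is represented by the sequence of its homogeneous parts: \<open>F m\<close> is the
  matrix-valued function on jets given by the terms with exactly \<open>m\<close> factors \<open>u\<^sub>I\<close>. Infinite sums
  are thus formal power series in the jet variables, without a requirement of convergence, while
  terms are compared as functions (for matrices of size 1 the algebra is commutative).
  Addition, subtraction and zero are pointwise.
\<close>

type_synonym ('k, 'n, 'd) jet_series = "nat \<Rightarrow> ('k, 'n, 'd) jet \<Rightarrow> 'k^'n^'n"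


subsection \<open>Base-space functions\<close>

definition has_partial ::
    "('d \<Rightarrow> real) set \<Rightarrow> 'd \<Rightarrow> (('d \<Rightarrow> real) \<Rightarrow> 'b::real_normed_vector) \<Rightarrow> (('d \<Rightarrow> real) \<Rightarrow> 'b) \<Rightarrow> bool" where
  "has_partial X i f g \<longleftrightarrow>
     (\<forall>x\<in>X. ((\<lambda>t. f (x(i := t))) has_vector_derivative g x) (at (x i)))"

primrec C_k_on ::
    "nat \<Rightarrow> ('d \<Rightarrow> real) set \<Rightarrow> (('d \<Rightarrow> real) \<Rightarrow> 'b::real_normed_vector) \<Rightarrow> bool" where
  "C_k_on 0 X f \<longleftrightarrow> continuous_on X f"
| "C_k_on (Suc k) X f \<longleftrightarrow>
     continuous_on X f \<and> (\<forall>i. \<exists>g. has_partial X i f g \<and> C_k_on k X g)"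

text \<open>
  Functions on \<open>X\<close> are extended by 0, so that equality of functions on \<open>X\<close> is plain equality.
\<close>

definition base_functions :: "('d \<Rightarrow> real) set \<Rightarrow> (('d \<Rightarrow> real) \<Rightarrow> 'k::real_normed_field^'n::finite^'n) set" where
  "base_functions X = {f. (\<forall>k. C_k_on k X f) \<and> (\<forall>x. x \<notin> X \<longrightarrow> f x = 0)}"


subsection \<open>The algebra of functions on the jet space\<close>

definition base_series ::
    "(('d \<Rightarrow> real) \<Rightarrow> 'k::real_normed_field^'n::finite^'n) \<Rightarrow> ('k, 'n, 'd) jet_series" where
  "base_series f = (\<lambda>m (x, v). if m = 0 then f x else 0)"

definition jet_var ::
    "('d \<Rightarrow> real) set \<Rightarrow> 'd multiset \<Rightarrow> ('k::real_normed_field, 'n::finite, 'd) jet_series" where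
  "jet_var X I = (\<lambda>m (x, v). if m = 1 \<and> x \<in> X then v I else 0)"

definition series_mult ::
    "('k::real_normed_field, 'n::finite, 'd) jet_series \<Rightarrow> ('k, 'n, 'd) jet_series \<Rightarrow> ('k, 'n, 'd) jet_series"
    (infixl \<open>\<circledast>\<close> 70) where
  "F \<circledast> G = (\<lambda>m p. \<Sum>k\<le>m. F k p ** G (m - k) p)"

definition series_scale ::
    "'k::real_normed_field \<Rightarrow> ('k, 'n::finite, 'd) jet_series \<Rightarrow> ('k, 'n, 'd) jet_series" where
  "series_scale c F = (\<lambda>m p. mat c ** F m p)"

text \<open>
  A term is a product \<open>a\<^sub>0 u\<^sub>I a\<^sub>1 u\<^sub>J a\<^sub>2 \<dots>\<close> of base-space functions and jet variables; powers and
  products of the variables arise by taking intermediate \<open>a\<^sub>j\<close> equal to 1.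
\<close>

inductive_set jet_terms ::
    "('d \<Rightarrow> real) set \<Rightarrow> ('k::real_normed_field, 'n::finite, 'd) jet_series set" for X where
  base: "f \<in> base_functions X \<Longrightarrow> base_series f \<in> jet_terms X"
| step: "f \<in> base_functions X \<Longrightarrow> P \<in> jet_terms X \<Longrightarrow> base_series f \<circledast> jet_var X I \<circledast> P \<in> jet_terms X"

text \<open>
  Formal summation: only finitely many summands contribute to each degree. A finite sum is the
  case where almost all summands are 0. Infinitely many contributions to one degree are not
  admitted, since characteristic derivatives are undefined on such sums: applied to the sum of all
  derivatives of \<open>u\<close>, \<open>\<Delta>\<^sub>f\<close> would give the sum of all derivatives of the base-space function \<open>f\<close>.
\<close>

definition series_sums ::
    "(nat \<Rightarrow> ('k::real_normed_field, 'n::finite, 'd) jet_series) \<Rightarrow> ('k, 'n, 'd) jet_series \<Rightarrow> bool" where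
  "series_sums T F \<longleftrightarrow>
     (\<forall>m. finite {k. T k m \<noteq> 0} \<and> F m = (\<Sum>k\<in>{k. T k m \<noteq> 0}. T k m))"

definition jet_algebra ::
    "('d \<Rightarrow> real) set \<Rightarrow> ('k::real_normed_field, 'n::finite, 'd) jet_series set" where
  "jet_algebra X = {F. \<exists>T. (\<forall>k. T k \<in> jet_terms X) \<and> series_sums T F}"


subsection \<open>Operators on the algebra\<close>

text \<open>
  Operators are functions on all of \<open>jet_series\<close>, but only their values on the algebra matter.
\<close>

definition linear_operator ::
    "('d \<Rightarrow> real) set \<Rightarrow> (('k::real_normed_field, 'n::finite, 'd) jet_series \<Rightarrow> ('k, 'n, 'd) jet_series) \<Rightarrow> bool" where
  "linear_operator X L \<longleftrightarrow>
     (\<forall>F\<in>jet_algebra X. L F \<in> jet_algebra X) \<and>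
     (\<forall>F\<in>jet_algebra X. \<forall>G\<in>jet_algebra X. L (F + G) = L F + L G) \<and>
     (\<forall>c. \<forall>F\<in>jet_algebra X. L (series_scale c F) = series_scale c (L F))"

definition acts_termwise ::
    "('d \<Rightarrow> real) set \<Rightarrow> (('k::real_normed_field, 'n::finite, 'd) jet_series \<Rightarrow> ('k, 'n, 'd) jet_series) \<Rightarrow> bool" where
  "acts_termwise X L \<longleftrightarrow>
     (\<forall>T F. (\<forall>k. T k \<in> jet_terms X) \<and> series_sums T F \<longrightarrow> series_sums (\<lambda>k. L (T k)) (L F))"

definition satisfies_Leibniz ::
    "('d \<Rightarrow> real) set \<Rightarrow> (('k::real_normed_field, 'n::finite, 'd) jet_series \<Rightarrow> ('k, 'n, 'd) jet_series) \<Rightarrow> bool" where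
  "satisfies_Leibniz X L \<longleftrightarrow>
     (\<forall>F\<in>jet_algebra X. \<forall>G\<in>jet_algebra X. L (F \<circledast> G) = L F \<circledast> G + F \<circledast> L G)"

text \<open>
  On the algebra, these conditions determine the operators \<open>D i\<close>, and make them commute.
\<close>

definition total_derivatives ::
    "('d \<Rightarrow> real) set \<Rightarrow> ('d \<Rightarrow> ('k::real_normed_field, 'n::finite, 'd) jet_series \<Rightarrow> ('k, 'n, 'd) jet_series) \<Rightarrow> bool" where
  "total_derivatives X D \<longleftrightarrow>
     (\<forall>i. linear_operator X (D i) \<and> acts_termwise X (D i) \<and>
       (\<forall>f\<in>base_functions X. \<forall>g\<in>base_functions X.
          has_partial X i f g \<longrightarrow> D i (base_series f) = base_series g) \<and>
       (\<forall>I. D i (jet_var X I) = jet_var X (add_mset i I)) \<and>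
       satisfies_Leibniz X (D i))"

definition characteristic_derivative ::
    "('d \<Rightarrow> real) set \<Rightarrow> ('d \<Rightarrow> ('k::real_normed_field, 'n::finite, 'd) jet_series \<Rightarrow> ('k, 'n, 'd) jet_series) \<Rightarrow>
     ('k, 'n, 'd) jet_series \<Rightarrow> (('k, 'n, 'd) jet_series \<Rightarrow> ('k, 'n, 'd) jet_series) \<Rightarrow> bool" where
  "characteristic_derivative X D Q \<Delta> \<longleftrightarrow>
     Q \<in> jet_algebra X \<and>
     linear_operator X \<Delta> \<and> acts_termwise X \<Delta> \<and>
     (\<forall>f\<in>base_functions X. \<Delta> (base_series f) = 0) \<and>
     \<Delta> (jet_var X {#}) = Q \<and>
     (\<forall>i. \<forall>F\<in>jet_algebra X. \<Delta> (D i F) = D i (\<Delta> F)) \<and>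
     satisfies_Leibniz X \<Delta>"

definition lie_bracket ::
    "(('k::real_normed_field, 'n::finite, 'd) jet_series \<Rightarrow> ('k, 'n, 'd) jet_series) \<Rightarrow>
     (('k, 'n, 'd) jet_series \<Rightarrow> ('k, 'n, 'd) jet_series) \<Rightarrow>
     ('k, 'n, 'd) jet_series \<Rightarrow> ('k, 'n, 'd) jet_series" where
  "lie_bracket \<Delta>\<^sub>1 \<Delta>\<^sub>2 = (\<lambda>F. \<Delta>\<^sub>1 (\<Delta>\<^sub>2 F) - \<Delta>\<^sub>2 (\<Delta>\<^sub>1 F))"

end

theory Submission imports Defs "HOL-Library.Nat_Bijection" begin

text \<open>
  The mixed terms \<open>\<Delta>\<^sub>1 F \<circledast> \<Delta>\<^sub>2 G + \<Delta>\<^sub>2 F \<circledast> \<Delta>\<^sub>1 G\<close> of \<open>\<Delta>\<^sub>1 (\<Delta>\<^sub>2 (F \<circledast> G))\<close> are symmetric in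
  \<open>\<Delta>\<^sub>1\<close> and \<open>\<Delta>\<^sub>2\<close> and cancel in the bracket, which gives the Leibniz rule. The delicate condition
  is that the bracket acts term by term: \<open>\<Delta>\<^sub>2\<close> maps terms to infinite sums, so one has to see that an
  operator acting termwise on sums of terms does so on sums of arbitrary elements of the algebra.
  For uniqueness, a characteristic derivative is determined on all \<open>u\<^sub>I\<close> by its value on \<open>u\<close>,
  because it commutes with total derivatives; hence on terms by the Leibniz rule, and then on sums.
\<close>

section \<open>Formal sums over arbitrary index types\<close>

text \<open>Double sums are indexed by pairs, hence the arbitrary index type;
  \<open>series_sums\<close> is the case of sequences.\<close>

definition family_sums :: "('i \<Rightarrow> nat \<Rightarrow> 'a::comm_monoid_add) \<Rightarrow> (nat \<Rightarrow> 'a) \<Rightarrow> bool" where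
  "family_sums T F \<longleftrightarrow>
     (\<forall>m. finite {i. T i m \<noteq> 0} \<and> F m = (\<Sum>i\<in>{i. T i m \<noteq> 0}. T i m))"

lemma series_sums_iff_family_sums: "series_sums T F \<longleftrightarrow> family_sums T F"
  by (simp add: series_sums_def family_sums_def)

text \<open>Enlarging a finite index set by indices that contribute 0 does not change the sum. A
  convenient finite set, chosen separately in each degree, can thus replace the exact
  support.\<close>

lemma family_sums_iff:
  "family_sums T F \<longleftrightarrow>
     (\<forall>m. \<exists>A. finite A \<and> (\<forall>i. i \<notin> A \<longrightarrow> T i m = 0) \<and> F m = (\<Sum>i\<in>A. T i m))"
proof
  assume "family_sums T F"
  then show "\<forall>m. \<exists>A. finite A \<and> (\<forall>i. i \<notin> A \<longrightarrow> T i m = 0) \<and> F m = (\<Sum>i\<in>A. T i m)"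
    unfolding family_sums_def by blast
next
  assume R: "\<forall>m. \<exists>A. finite A \<and> (\<forall>i. i \<notin> A \<longrightarrow> T i m = 0) \<and> F m = (\<Sum>i\<in>A. T i m)"
  show "family_sums T F"
    unfolding family_sums_def
  proof
    fix m
    obtain A where A: "finite A" "\<forall>i. i \<notin> A \<longrightarrow> T i m = 0" "F m = (\<Sum>i\<in>A. T i m)"
      using R by blast
    have sub: "{i. T i m \<noteq> 0} \<subseteq> A" using A(2) by blast
    have "(\<Sum>i\<in>{i. T i m \<noteq> 0}. T i m) = (\<Sum>i\<in>A. T i m)"
      using A(1) sub by (intro sum.mono_neutral_left) auto
    then show "finite {i. T i m \<noteq> 0} \<and> F m = (\<Sum>i\<in>{i. T i m \<noteq> 0}. T i m)"
      using A(1,3) sub finite_subset by auto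
  qed
qed

lemma family_sums_superset:
  assumes "family_sums T F" "finite A" "\<And>i. i \<notin> A \<Longrightarrow> T i m = 0"
  shows "F m = (\<Sum>i\<in>A. T i m)"
proof -
  have "(\<Sum>i\<in>{i. T i m \<noteq> 0}. T i m) = (\<Sum>i\<in>A. T i m)"
    using assms(2,3) by (intro sum.mono_neutral_left) auto
  then show ?thesis using assms(1) by (simp add: family_sums_def)
qed

lemma family_sums_unique: "family_sums T F \<Longrightarrow> family_sums T G \<Longrightarrow> F = G"
  by (auto simp: family_sums_def fun_eq_iff)

lemma family_sums_reindex:
  assumes "bij h" "family_sums T F"
  shows "family_sums (\<lambda>j. T (h j)) F"
  unfolding family_sums_iff
proof
  fix m
  let ?A = "{i. T i m \<noteq> 0}"
  have bij: "bij_betw h (h -` ?A) ?A"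
    using assms(1) by (auto simp: bij_betw_def bij_def inj_on_def surj_def)
  have "finite (h -` ?A)"
    using bij assms(2) bij_betw_finite by (auto simp: family_sums_def)
  moreover have "F m = (\<Sum>j\<in>h -` ?A. T (h j) m)"
    using assms(2) sum.reindex_bij_betw[OF bij, of "\<lambda>i. T i m"] by (simp add: family_sums_def)
  ultimately show "\<exists>B. finite B \<and> (\<forall>j. j \<notin> B \<longrightarrow> T (h j) m = 0) \<and> F m = (\<Sum>j\<in>B. T (h j) m)"
    by (intro exI[of _ "h -` ?A"]) auto
qed

lemma family_sums_diff:
  fixes S T :: "'i \<Rightarrow> nat \<Rightarrow> 'a::ab_group_add"
  assumes "family_sums S F" "family_sums T G"
  shows "family_sums (\<lambda>i. S i - T i) (F - G)"
  unfolding family_sums_iff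
proof
  fix m
  let ?A = "{i. S i m \<noteq> 0} \<union> {i. T i m \<noteq> 0}"
  have fin: "finite ?A" using assms by (simp add: family_sums_def)
  moreover have "F m = (\<Sum>i\<in>?A. S i m)" "G m = (\<Sum>i\<in>?A. T i m)"
    using assms fin by (auto intro!: family_sums_superset)
  ultimately show "\<exists>A. finite A \<and> (\<forall>i. i \<notin> A \<longrightarrow> (S i - T i) m = 0) \<and> (F - G) m = (\<Sum>i\<in>A. (S i - T i) m)"
    by (intro exI[of _ ?A]) (auto simp: sum_subtractf)
qed

lemma family_sums_minus:
  fixes S :: "'i \<Rightarrow> nat \<Rightarrow> 'a::ab_group_add"
  assumes "family_sums S F"
  shows "family_sums (\<lambda>i. - S i) (- F)"
  using assms by (simp add: family_sums_def sum_negf)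

text \<open>The condition \<open>vanish\<close> confines degree \<open>m\<close> to the finitely
  many rows with \<open>G k m \<noteq> 0\<close>. Otherwise infinitely many rows could have nonzero
  entries that cancel within each row, and the double family would not be summable.\<close>

lemma family_sums_Sigma:
  assumes G: "family_sums G H" and S: "\<And>k. family_sums (S k) (G k)"
    and vanish: "\<And>k j m. G k m = 0 \<Longrightarrow> S k j m = 0"
  shows "family_sums (\<lambda>(k, j). S k j) H"
  unfolding family_sums_iff
proof
  fix m
  let ?A = "{k. G k m \<noteq> 0}" and ?B = "\<lambda>k. {j. S k j m \<noteq> 0}"
  have "finite ?A" "\<And>k. finite (?B k)" using G S by (simp_all add: family_sums_def)
  moreover have "H m = (\<Sum>k\<in>?A. \<Sum>j\<in>?B k. S k j m)"
    using G S by (simp add: family_sums_def)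
  ultimately show "\<exists>C. finite C \<and> (\<forall>i. i \<notin> C \<longrightarrow> (case i of (k, j) \<Rightarrow> S k j) m = 0) \<and>
      H m = (\<Sum>i\<in>C. (case i of (k, j) \<Rightarrow> S k j) m)"
    using vanish by (intro exI[of _ "Sigma ?A ?B"]) (auto simp: sum.Sigma split_def)
qed

text \<open>Joint summability leaves finitely many pairs in each degree, and only their first
  components can index a nonzero row sum.\<close>

lemma family_sums_regroup:
  assumes U: "family_sums (\<lambda>(k, j). U k j) H" and G: "\<And>k. family_sums (U k) (G k)"
  shows "family_sums G H"
  unfolding family_sums_iff
proof
  fix m
  let ?C = "{(k, j). U k j m \<noteq> 0}"
  have fin: "finite ?C" using U by (simp add: family_sums_def split_def)
  have H: "H m = (\<Sum>(k, j)\<in>?C. U k j m)"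
    using U by (simp add: family_sums_def split_def)
  have B: "finite {j. U k j m \<noteq> 0}" "G k m = (\<Sum>j\<in>{j. U k j m \<noteq> 0}. U k j m)" for k
    using G by (simp_all add: family_sums_def)
  have C: "?C = Sigma (fst ` ?C) (\<lambda>k. {j. U k j m \<noteq> 0})" by force
  have "H m = (\<Sum>k\<in>fst ` ?C. G k m)"
    unfolding H B(2) using fin B(1) by (subst C) (simp add: sum.Sigma)
  moreover have "G k m = 0" if "k \<notin> fst ` ?C" for k
  proof -
    have "{j. U k j m \<noteq> 0} = {}" using that by force
    then show ?thesis using B(2)[of k] by simp
  qed
  ultimately show "\<exists>A. finite A \<and> (\<forall>k. k \<notin> A \<longrightarrow> G k m = 0) \<and> H m = (\<Sum>k\<in>A. G k m)"
    using fin by blast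
qed


section \<open>Smooth functions\<close>

text \<open>Bilinearity serves twice: boundedness gives continuity and the product rule for
  matrix-valued functions, and the algebraic part distributes \<open>**\<close> over sums and
  differences.\<close>

lemma bounded_bilinear_matrix_mult:
  "bounded_bilinear ((**) :: 'k::real_normed_field^'n::finite^'n \<Rightarrow> 'k^'n^'n \<Rightarrow> 'k^'n^'n)"
proof
  fix A A' B B' :: "'k^'n^'n" and r :: real
  show "(A + A') ** B = A ** B + A' ** B"
    by (simp add: matrix_matrix_mult_def vec_eq_iff distrib_right sum.distrib)
  show "A ** (B + B') = A ** B + A ** B'"
    by (rule matrix_add_ldistrib)
  show "(r *\<^sub>R A) ** B = r *\<^sub>R (A ** B)"
    by (simp add: matrix_matrix_mult_def vec_eq_iff scaleR_sum_right)
  show "A ** (r *\<^sub>R B) = r *\<^sub>R (A ** B)"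
    by (simp add: matrix_matrix_mult_def vec_eq_iff scaleR_sum_right)
  show "\<exists>K. \<forall>(A :: 'k^'n^'n) (B :: 'k^'n^'n). norm (A ** B) \<le> norm A * norm B * K"
  proof (intro exI allI)
    fix A B :: "'k^'n^'n"
    have entry: "norm (M $ i $ j) \<le> norm M" for M :: "'k^'n^'n" and i j
      using Finite_Cartesian_Product.norm_nth_le[of M i] Finite_Cartesian_Product.norm_nth_le[of "M $ i" j] by simp
    have product: "norm ((A ** B) $ i $ j) \<le> (\<Sum>k\<in>(UNIV::'n set). norm A * norm B)" for i j
    proof -
      have "norm (A $ i $ k * B $ k $ j) \<le> norm A * norm B" for k
        unfolding norm_mult by (intro mult_mono entry norm_ge_zero)
      then have "norm (\<Sum>k\<in>UNIV. A $ i $ k * B $ k $ j) \<le> (\<Sum>k\<in>(UNIV::'n set). norm A * norm B)"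
        by (intro sum_norm_le)
      then show ?thesis by (simp only: matrix_matrix_mult_def vec_lambda_beta)
    qed
    \<comment> \<open>The norm is at most the sum of the norms of the entries. There are n^2
      entries, each bounded by n times \<open>norm A * norm B\<close>, so the constant is
      n^3.\<close>
    have row: "norm v \<le> (\<Sum>j\<in>UNIV. norm (v $ j))" for v :: "'b::real_normed_vector^'m::finite"
      unfolding norm_vec_def by (rule L2_set_le_sum) simp
    have "norm (A ** B) \<le> (\<Sum>i\<in>UNIV. \<Sum>j\<in>UNIV. norm ((A ** B) $ i $ j))"
      by (rule order_trans[OF row sum_mono]) (rule row)
    also have "\<dots> \<le> (\<Sum>i\<in>(UNIV::'n set). \<Sum>j\<in>(UNIV::'n set). \<Sum>k\<in>(UNIV::'n set). norm A * norm B)"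
      by (intro sum_mono product)
    finally show "norm (A ** B) \<le> norm A * norm B * (real CARD('n) * (real CARD('n) * real CARD('n)))"
      by (simp add: mult_ac)
  qed
qed

text \<open>The product rule contains the undifferentiated factors, which an induction on
  \<open>k\<close> must therefore have at the lower order as well.\<close>

lemma C_k_on_pred: "C_k_on (Suc k) X f \<Longrightarrow> C_k_on k X f"
proof (induction k arbitrary: f)
  case (Suc k)
  have "\<exists>g. has_partial X i f g \<and> C_k_on k X g" for i
  proof -
    obtain g where "has_partial X i f g" "C_k_on (Suc k) X g"
      using Suc.prems unfolding C_k_on.simps(2)[of "Suc k"] by blast
    then show ?thesis using Suc.IH by blast
  qed
  then show ?case using Suc.prems by simp
qed simp

lemma C_k_on_add: "C_k_on k X f \<Longrightarrow> C_k_on k X g \<Longrightarrow> C_k_on k X (\<lambda>x. f x + g x)"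
proof (induction k arbitrary: f g)
  case (Suc k)
  have "\<exists>h. has_partial X i (\<lambda>x. f x + g x) h \<and> C_k_on k X h" for i
  proof -
    obtain f' g' where "has_partial X i f f'" "C_k_on k X f'" "has_partial X i g g'" "C_k_on k X g'"
      using Suc.prems unfolding C_k_on.simps(2) by blast
    then show ?thesis
      using Suc.IH by (intro exI[of _ "\<lambda>x. f' x + g' x"]) (auto simp: has_partial_def intro: has_vector_derivative_add)
  qed
  then show ?case using Suc.prems by (auto intro: continuous_on_add)
qed (auto intro: continuous_on_add)

lemma C_k_on_minus: "C_k_on k X f \<Longrightarrow> C_k_on k X (\<lambda>x. - f x)"
proof (induction k arbitrary: f)
  case (Suc k)
  have "\<exists>h. has_partial X i (\<lambda>x. - f x) h \<and> C_k_on k X h" for i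
  proof -
    obtain f' where "has_partial X i f f'" "C_k_on k X f'"
      using Suc.prems unfolding C_k_on.simps(2) by blast
    then show ?thesis
      using Suc.IH by (intro exI[of _ "\<lambda>x. - f' x"]) (auto simp: has_partial_def intro: has_vector_derivative_minus)
  qed
  then show ?case using Suc.prems by (auto intro: continuous_on_minus)
qed (auto intro: continuous_on_minus)

text \<open>A partial derivative of the product is a sum of two products of the same shape, to which
  the induction hypothesis for arbitrary factors applies.\<close>

lemma C_k_on_bilinear:
  assumes bil: "bounded_bilinear op"
  shows "C_k_on k X f \<Longrightarrow> C_k_on k X g \<Longrightarrow> C_k_on k X (\<lambda>x. op (f x) (g x))"
proof (induction k arbitrary: f g)
  case 0
  then show ?case by (auto intro: bounded_bilinear.continuous_on[OF bil])
next
  case (Suc k)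
  have "\<exists>h. has_partial X i (\<lambda>x. op (f x) (g x)) h \<and> C_k_on k X h" for i
  proof -
    obtain f' g' where d: "has_partial X i f f'" "C_k_on k X f'" "has_partial X i g g'" "C_k_on k X g'"
      using Suc.prems unfolding C_k_on.simps(2) by blast
    have "has_partial X i (\<lambda>x. op (f x) (g x)) (\<lambda>x. op (f x) (g' x) + op (f' x) (g x))"
      unfolding has_partial_def
    proof
      fix x assume "x \<in> X"
      then have "((\<lambda>t. f (x(i := t))) has_vector_derivative f' x) (at (x i))"
        "((\<lambda>t. g (x(i := t))) has_vector_derivative g' x) (at (x i))"
        using d by (auto simp: has_partial_def)
      from bounded_bilinear.has_vector_derivative[OF bil this]
      show "((\<lambda>t. op (f (x(i := t))) (g (x(i := t)))) has_vector_derivative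
          op (f x) (g' x) + op (f' x) (g x)) (at (x i))"
        by simp
    qed
    moreover have "C_k_on k X (\<lambda>x. op (f x) (g' x) + op (f' x) (g x))"
      by (intro C_k_on_add Suc.IH d Suc.prems[THEN C_k_on_pred])
    ultimately show ?thesis by blast
  qed
  moreover have "continuous_on X (\<lambda>x. op (f x) (g x))"
    using Suc.prems by (auto intro: bounded_bilinear.continuous_on[OF bil])
  ultimately show ?case by simp
qed

lemma C_k_on_zero: "C_k_on k X (\<lambda>x. 0)"
proof (induction k)
  case (Suc k)
  moreover have "has_partial X i (\<lambda>x. 0) (\<lambda>x. 0)" for i
    by (simp add: has_partial_def)
  ultimately show ?case
    unfolding C_k_on.simps(2) by (intro conjI allI exI[of _ "\<lambda>x. 0"] continuous_on_const)
qed simp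

text \<open>Base-space functions are extended by 0, so even the constant 1 must be cut off outside
  \<open>X\<close>. As \<open>X\<close> is open, the jump is never seen near a point of
  \<open>X\<close>.\<close>

lemma C_k_on_locally_constant:
  fixes c :: "'b::real_normed_vector"
  assumes "open X"
  shows "C_k_on k X (\<lambda>x. if x \<in> X then c else 0)"
proof -
  have cont: "continuous_on X (\<lambda>x. if x \<in> X then c else 0)"
    by (rule continuous_on_eq[OF continuous_on_const[of X c]]) simp
  show ?thesis
  proof (cases k)
    case (Suc k')
    have "has_partial X i (\<lambda>x. if x \<in> X then c else 0) (\<lambda>x. 0)" for i
      unfolding has_partial_def
    proof
      fix x assume x: "x \<in> X"
      let ?S = "(\<lambda>t. x(i := t)) -` X"
      \<comment> \<open>A coordinate line is a continuous curve in the product topology, so it stays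
        in the open set \<open>X\<close> for \<open>t\<close> near \<open>x i\<close>, where the
        function is constant.\<close>
      have "continuous_on UNIV (\<lambda>t. x(i := t))"
      proof (rule continuous_on_coordinatewise_then_product)
        fix j show "continuous_on UNIV (\<lambda>t. (x(i := t)) j)"
          by (cases "j = i") auto
      qed
      then have "open ?S" using assms by (simp add: open_vimage)
      then show "((\<lambda>t. if x(i := t) \<in> X then c else 0) has_vector_derivative 0) (at (x i))"
        by (rule has_vector_derivative_transform_within_open[OF has_vector_derivative_const[of c]])
          (use x in auto)
    qed
    then show ?thesis
      unfolding Suc C_k_on.simps(2) by (intro conjI allI exI[of _ "\<lambda>x. 0"] cont C_k_on_zero)
  qed (simp add: cont)
qed

section \<open>Closure properties of base-space functions\<close>

lemma base_functions_zero: "(\<lambda>x. 0) \<in> base_functions X"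
  by (simp add: base_functions_def C_k_on_zero)

lemma base_functions_minus: "f \<in> base_functions X \<Longrightarrow> (\<lambda>x. - f x) \<in> base_functions X"
  by (simp add: base_functions_def C_k_on_minus)

lemma base_functions_mult:
  "f \<in> base_functions X \<Longrightarrow> g \<in> base_functions X \<Longrightarrow> (\<lambda>x. f x ** g x) \<in> base_functions X"
  by (simp add: base_functions_def C_k_on_bilinear[OF bounded_bilinear_matrix_mult])

lemma base_functions_indicator: "open X \<Longrightarrow> (\<lambda>x. if x \<in> X then mat 1 else 0) \<in> base_functions X"
  by (simp add: base_functions_def C_k_on_locally_constant)


section \<open>Multiplication of jet series\<close>

context
begin

interpretation mm: bounded_bilinear "(**) :: 'k::real_normed_field^'n::finite^'n \<Rightarrow> 'k^'n^'n \<Rightarrow> 'k^'n^'n"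
  by (rule bounded_bilinear_matrix_mult)

lemma series_mult_assoc: "F \<circledast> G \<circledast> H = F \<circledast> (G \<circledast> H)"
proof (intro ext)
  fix m p
  have "(F \<circledast> G \<circledast> H) m p = (\<Sum>j=0..m. \<Sum>i=0..j. F i p ** G (j - i) p ** H (m - j) p)"
    by (simp add: series_mult_def mm.sum_left atLeast0AtMost)
  \<comment> \<open>Both sums run over all triples of degrees with total \<open>m\<close>. The
    reindexing holds for values in any commutative monoid, so \<open>**\<close> may stand in the
    summands.\<close>
  also have "\<dots> = (\<Sum>j=0..m. \<Sum>i=0..m - j. F j p ** G i p ** H (m - j - i) p)"
    by (rule fps_mult_assoc_lemma)
  also have "\<dots> = (F \<circledast> (G \<circledast> H)) m p"
    by (simp add: series_mult_def mm.sum_right atLeast0AtMost matrix_mul_assoc)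
  finally show "(F \<circledast> G \<circledast> H) m p = (F \<circledast> (G \<circledast> H)) m p" .
qed

lemma series_mult_diff_left: "(F - G) \<circledast> H = F \<circledast> H - G \<circledast> H"
  by (simp add: series_mult_def fun_eq_iff mm.diff_left sum_subtractf)

lemma series_mult_diff_right: "F \<circledast> (G - H) = F \<circledast> G - F \<circledast> H"
  by (simp add: series_mult_def fun_eq_iff mm.diff_right sum_subtractf)

lemma series_mult_minus_left: "(- F) \<circledast> G = - (F \<circledast> G)"
  by (simp add: series_mult_def fun_eq_iff mm.minus_left sum_negf)

lemma series_scale_diff: "series_scale c (F - G) = series_scale c F - series_scale c G"
  by (simp add: series_scale_def fun_eq_iff mm.diff_right)

lemma sum_apply: "(\<Sum>i\<in>A. f i) x = (\<Sum>i\<in>A. f i x)"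
  by (induction A rule: infinite_finite_induct) auto

text \<open>Degree \<open>m\<close> of a product involves only degrees up to \<open>m\<close> of the
  factors. The indices contributing to one of these degrees form the finite sets \<open>?A\<close>
  and \<open>?B\<close>, and the summands outside \<open>?A \<times> ?B\<close> vanish in degree
  \<open>m\<close>.\<close>

lemma family_sums_mult:
  fixes F G :: "('k::real_normed_field, 'n::finite, 'd) jet_series"
  assumes T: "family_sums T F" and S: "family_sums S G"
  shows "family_sums (\<lambda>(k, j). T k \<circledast> S j) (F \<circledast> G)"
  unfolding family_sums_iff
proof
  fix m
  let ?A = "\<Union>a\<le>m. {k. T k a \<noteq> 0}" and ?B = "\<Union>a\<le>m. {j. S j a \<noteq> 0}"
  have fin: "finite ?A" "finite ?B" using T S by (auto simp: family_sums_def)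
  have F: "F a = (\<Sum>k\<in>?A. T k a)" if "a \<le> m" for a
    using that fin by (intro family_sums_superset[OF T]) auto
  have G: "G a = (\<Sum>j\<in>?B. S j a)" if "a \<le> m" for a
    using that fin by (intro family_sums_superset[OF S]) auto
  have zero: "(T k \<circledast> S j) m = 0" if "(k, j) \<notin> ?A \<times> ?B" for k j
    using that by (auto simp: series_mult_def fun_eq_iff mm.zero_left mm.zero_right)
  have "(F \<circledast> G) m p = (\<Sum>(k, j)\<in>?A \<times> ?B. (T k \<circledast> S j) m) p" for p
  proof -
    have "(F \<circledast> G) m p = (\<Sum>a\<le>m. \<Sum>k\<in>?A. \<Sum>j\<in>?B. T k a p ** S j (m - a) p)"
      by (simp add: series_mult_def F G sum_apply mm.sum_left mm.sum_right) (subst sum.swap[of _ ?A ?B], rule refl)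
    also have "\<dots> = (\<Sum>k\<in>?A. \<Sum>j\<in>?B. \<Sum>a\<le>m. T k a p ** S j (m - a) p)"
      by (subst sum.swap) (intro sum.cong refl sum.swap)
    also have "\<dots> = (\<Sum>k\<in>?A. \<Sum>j\<in>?B. (T k \<circledast> S j) m p)"
      by (simp add: series_mult_def)
    finally show ?thesis by (simp add: sum_apply sum.cartesian_product split_def)
  qed
  then have "(F \<circledast> G) m = (\<Sum>(k, j)\<in>?A \<times> ?B. (T k \<circledast> S j) m)" by blast
  then show "\<exists>C. finite C \<and> (\<forall>i. i \<notin> C \<longrightarrow> (case i of (k, j) \<Rightarrow> T k \<circledast> S j) m = 0) \<and>
      (F \<circledast> G) m = (\<Sum>i\<in>C. (case i of (k, j) \<Rightarrow> T k \<circledast> S j) m)"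
    using fin zero by (intro exI[of _ "?A \<times> ?B"]) (auto simp: split_def)
qed

lemma homogeneous_mult:
  fixes F G :: "('k::real_normed_field, 'n::finite, 'd) jet_series"
  assumes "\<And>m. m \<noteq> a \<Longrightarrow> F m = 0" "\<And>m. m \<noteq> b \<Longrightarrow> G m = 0" "m \<noteq> a + b"
  shows "(F \<circledast> G) m = 0"
proof
  fix p
  have "F k p ** G (m - k) p = 0" if "k \<le> m" for k
    using assms(1)[of k] assms(2)[of "m - k"] assms(3) that
    by (cases "k = a") (auto simp: mm.zero_left mm.zero_right)
  then show "(F \<circledast> G) m p = 0 p" by (simp add: series_mult_def)
qed

section \<open>Products with base-space functions\<close>

lemma base_series_mult_nth: "(base_series f \<circledast> F) m p = f (fst p) ** F m p"
proof -
  have "(base_series f \<circledast> F) m p = (\<Sum>k\<in>{0}. base_series f k p ** F (m - k) p)"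
    unfolding series_mult_def
    by (intro sum.mono_neutral_right) (auto simp: base_series_def mm.zero_left split: prod.splits)
  then show ?thesis by (simp add: base_series_def split_def)
qed

lemma mult_base_series_nth: "(F \<circledast> base_series f) m p = F m p ** f (fst p)"
proof -
  have "(F \<circledast> base_series f) m p = (\<Sum>k\<in>{m}. F k p ** base_series f (m - k) p)"
    unfolding series_mult_def
    by (intro sum.mono_neutral_right) (auto simp: base_series_def mm.zero_right split: prod.splits)
  then show ?thesis by (simp add: base_series_def split_def)
qed

lemma base_series_mult: "base_series f \<circledast> base_series g = base_series (\<lambda>x. f x ** g x)"
  by (auto simp: fun_eq_iff base_series_mult_nth) (auto simp: base_series_def mm.zero_right)

end

lemma base_series_zero: "base_series (\<lambda>x. 0) = 0"
  by (auto simp: base_series_def fun_eq_iff)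

lemma base_series_minus: "base_series (\<lambda>x. - f x) = - base_series f"
  by (auto simp: base_series_def fun_eq_iff)

text \<open>A term begins and ends with a base-space function; padding with the cut-off identity
  matrix exhibits a bare variable as a term.\<close>

lemma jet_var_eq_product:
  "base_series (\<lambda>x. if x \<in> X then mat 1 else 0) \<circledast> jet_var X I \<circledast> base_series (\<lambda>x. if x \<in> X then mat 1 else 0)
    = jet_var X I"
  by (auto simp: fun_eq_iff base_series_mult_nth mult_base_series_nth jet_var_def
      bounded_bilinear.zero_left[OF bounded_bilinear_matrix_mult]
      bounded_bilinear.zero_right[OF bounded_bilinear_matrix_mult])


section \<open>Closure properties of the algebra\<close>

lemma jet_terms_zero: "0 \<in> jet_terms X"
  using jet_terms.base[OF base_functions_zero] by (simp add: base_series_zero)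

text \<open>The sign is absorbed into the leading coefficient.\<close>

lemma jet_terms_minus: "P \<in> jet_terms X \<Longrightarrow> - P \<in> jet_terms X"
proof (induction rule: jet_terms.induct)
  case (base f)
  then show ?case using jet_terms.base[OF base_functions_minus] by (metis base_series_minus)
next
  case (step f P I)
  then have "base_series (\<lambda>x. - f x) \<circledast> jet_var X I \<circledast> P \<in> jet_terms X"
    by (intro jet_terms.step base_functions_minus)
  then show ?case by (simp only: base_series_minus series_mult_minus_left)
qed

text \<open>The factor merges with the leading coefficient. When two terms are concatenated, this is
  what happens where the last coefficient of one meets the first of the other.\<close>

lemma jet_terms_mult_base:
  assumes "f \<in> base_functions X" "P \<in> jet_terms X"
  shows "base_series f \<circledast> P \<in> jet_terms X"
  using assms(2)
proof cases
  case (base g)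
  then show ?thesis by (auto simp: base_series_mult intro!: jet_terms.base base_functions_mult assms)
next
  case (step g P' I)
  have "base_series (\<lambda>x. f x ** g x) \<circledast> jet_var X I \<circledast> P' \<in> jet_terms X"
    using step assms by (intro jet_terms.step base_functions_mult)
  then show ?thesis by (simp add: step base_series_mult[symmetric] series_mult_assoc)
qed

lemma jet_terms_mult: "P \<in> jet_terms X \<Longrightarrow> R \<in> jet_terms X \<Longrightarrow> P \<circledast> R \<in> jet_terms X"
proof (induction rule: jet_terms.induct)
  case (base f)
  then show ?case by (rule jet_terms_mult_base)
next
  case (step f P I)
  then have "base_series f \<circledast> jet_var X I \<circledast> (P \<circledast> R) \<in> jet_terms X"
    by (intro jet_terms.step) auto
  then show ?case by (simp add: series_mult_assoc)
qed

text \<open>The degree \<open>N\<close> is the number of jet variables in the product.\<close>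

lemma jet_terms_homogeneous: "P \<in> jet_terms X \<Longrightarrow> \<exists>N. \<forall>m. m \<noteq> N \<longrightarrow> P m = 0"
proof (induction rule: jet_terms.induct)
  case (base f)
  then show ?case by (intro exI[of _ 0]) (auto simp: base_series_def fun_eq_iff)
next
  case (step f P I)
  then obtain N where N: "\<And>m. m \<noteq> N \<Longrightarrow> P m = 0" by blast
  have "(base_series f \<circledast> jet_var X I) m = 0" if "m \<noteq> 0 + 1" for m
    using that by (rule homogeneous_mult[rotated 2]) (auto simp: base_series_def jet_var_def fun_eq_iff)
  then have "(base_series f \<circledast> jet_var X I \<circledast> P) m = 0" if "m \<noteq> (0 + 1) + N" for m
    using that by (intro homogeneous_mult[OF _ N that])
  then show ?case by blast
qed

lemma jet_terms_in_algebra: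
  assumes "P \<in> jet_terms X"
  shows "P \<in> jet_algebra X"
proof -
  let ?T = "\<lambda>k::nat. if k = 0 then P else 0"
  have "family_sums ?T P"
    unfolding family_sums_iff by (intro allI exI[of _ "{0}"]) auto
  then show ?thesis
    using assms jet_terms_zero by (auto simp: jet_algebra_def series_sums_iff_family_sums intro!: exI[of _ ?T])
qed

lemma jet_algebra_zero: "0 \<in> jet_algebra X"
  by (intro jet_terms_in_algebra jet_terms_zero)

text \<open>Elements of the algebra are sums of sequences of terms; the pairing bijection turns a
  double series into a sequence.\<close>

lemma jet_algebra_family:
  fixes T :: "nat \<times> nat \<Rightarrow> ('k::real_normed_field, 'n::finite, 'd) jet_series"
  assumes "\<And>i. T i \<in> jet_terms X" "family_sums T F"
  shows "F \<in> jet_algebra X"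
  unfolding jet_algebra_def series_sums_iff_family_sums
  by (intro CollectI exI[of _ "\<lambda>k. T (prod_decode k)"] conjI allI assms(1)
      family_sums_reindex[OF bij_prod_decode assms(2)])

lemma jet_algebra_mult:
  assumes "F \<in> jet_algebra X" "G \<in> jet_algebra X"
  shows "F \<circledast> G \<in> jet_algebra X"
proof -
  obtain T S :: "nat \<Rightarrow> _" where "\<And>k. T k \<in> jet_terms X" "family_sums T F" "\<And>k. S k \<in> jet_terms X" "family_sums S G"
    using assms by (auto simp: jet_algebra_def series_sums_iff_family_sums)
  then show ?thesis
    by (intro jet_algebra_family[OF _ family_sums_mult]) (auto intro: jet_terms_mult)
qed

lemma jet_algebra_minus: "F \<in> jet_algebra X \<Longrightarrow> - F \<in> jet_algebra X"
  unfolding jet_algebra_def series_sums_iff_family_sums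
  using jet_terms_minus family_sums_minus by fast

text \<open>Since terms are homogeneous, those of a degree \<open>m\<close> in which \<open>F\<close> vanishes can be dropped.
  This keeps a double series of terms summable when the inner sums are.\<close>

lemma jet_algebra_reduced_terms:
  assumes "F \<in> jet_algebra X"
  obtains S :: "nat \<Rightarrow> _" where "\<And>k. S k \<in> jet_terms X" "family_sums S F" "\<And>k m. F m = 0 \<Longrightarrow> S k m = 0"
proof -
  obtain T :: "nat \<Rightarrow> _" where T: "\<And>k. T k \<in> jet_terms X" "family_sums T F"
    using assms by (auto simp: jet_algebra_def series_sums_iff_family_sums)
  define S where "S k = (if \<exists>m. T k m \<noteq> 0 \<and> F m = 0 then 0 else T k)" for k
  have S: "S k m = (if F m = 0 then 0 else T k m)" for k m
  proof -
    obtain N where "\<And>m. m \<noteq> N \<Longrightarrow> T k m = 0" using jet_terms_homogeneous[OF T(1)] by blast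
    then show ?thesis by (auto simp: S_def) metis+
  qed
  have "family_sums S F"
    unfolding family_sums_iff
  proof
    fix m
    show "\<exists>A. finite A \<and> (\<forall>k. k \<notin> A \<longrightarrow> S k m = 0) \<and> F m = (\<Sum>k\<in>A. S k m)"
    proof (cases "F m = 0")
      case True
      then show ?thesis by (intro exI[of _ "{}"]) (simp add: S)
    next
      case False
      then show ?thesis using T(2) by (auto simp: S family_sums_def)
    qed
  qed
  moreover have "S k \<in> jet_terms X" for k by (simp add: S_def T(1) jet_terms_zero)
  ultimately show ?thesis using S by (intro that[of S]) auto
qed

text \<open>Expanding each \<open>G k\<close> into reduced terms supplies the condition
  \<open>vanish\<close> of \<open>family_sums_Sigma\<close>; arbitrary expansions might fail to be
  jointly summable.\<close>

lemma jet_algebra_double_series: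
  fixes G :: "nat \<Rightarrow> _"
  assumes "\<And>k. G k \<in> jet_algebra X" "family_sums G H"
  obtains S :: "nat \<Rightarrow> nat \<Rightarrow> _" where "\<And>k j. S k j \<in> jet_terms X" "\<And>k. family_sums (S k) (G k)"
    "family_sums (\<lambda>(k, j). S k j) H"
proof -
  have "\<exists>S :: nat \<Rightarrow> _. (\<forall>j. S j \<in> jet_terms X) \<and> family_sums S (G k) \<and>
      (\<forall>j m. G k m = 0 \<longrightarrow> S j m = 0)" for k
    by (rule jet_algebra_reduced_terms[OF assms(1)[of k]]) blast
  then obtain S :: "nat \<Rightarrow> nat \<Rightarrow> _" where S: "\<forall>k. (\<forall>j. S k j \<in> jet_terms X) \<and>
      family_sums (S k) (G k) \<and> (\<forall>j m. G k m = 0 \<longrightarrow> S k j m = 0)"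
    using choice[of "\<lambda>k S. (\<forall>j. S j \<in> jet_terms X) \<and> family_sums S (G k) \<and>
      (\<forall>j m. G k m = 0 \<longrightarrow> S j m = 0)"] by blast
  show ?thesis
  proof (rule that)
    show "family_sums (\<lambda>(k, j). S k j) H"
      by (rule family_sums_Sigma[OF assms(2)]) (use S in auto)
  qed (use S in auto)
qed

lemma jet_algebra_diff:
  assumes "F \<in> jet_algebra X" "G \<in> jet_algebra X"
  shows "F - G \<in> jet_algebra X"
proof -
  \<comment> \<open>The difference is read as an infinite sum padded with zeros, so that its
    expansion into a double series of terms also yields closure under differences.\<close>
  define H where "H k = (if k = 0 then F else if k = 1 then - G else 0)" for k :: nat
  have H: "H k \<in> jet_algebra X" for k
    using assms by (auto simp: H_def intro: jet_algebra_minus jet_algebra_zero)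
  have sums: "family_sums H (F - G)"
    unfolding family_sums_iff by (intro allI exI[of _ "{0, 1}"]) (auto simp: H_def)
  show ?thesis
  proof (rule jet_algebra_double_series[OF H sums])
    fix S :: "nat \<Rightarrow> nat \<Rightarrow> _"
    assume S: "\<And>k j. S k j \<in> jet_terms X" "family_sums (\<lambda>(k, j). S k j) (F - G)"
    show ?thesis by (rule jet_algebra_family[OF _ S(2)]) (simp add: S(1) split: prod.split)
  qed
qed

lemma jet_var_in_algebra: "open X \<Longrightarrow> jet_var X I \<in> jet_algebra X"
  by (subst jet_var_eq_product[symmetric])
    (intro jet_terms_in_algebra jet_terms.step jet_terms.base base_functions_indicator)


section \<open>Operators on the algebra\<close>

text \<open>\<open>H\<close> is expanded into a double series of terms. Termwise action on the whole
  series gives \<open>L H\<close>, on row \<open>k\<close> it gives \<open>L (G k)\<close>, and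
  regrouping compares the two.\<close>

lemma acts_termwise_algebra:
  fixes G :: "nat \<Rightarrow> _"
  assumes L: "acts_termwise X L" and G: "\<And>k. G k \<in> jet_algebra X" "family_sums G H"
  shows "family_sums (\<lambda>k. L (G k)) (L H)"
proof -
  obtain S :: "nat \<Rightarrow> nat \<Rightarrow> _" where S: "\<And>k j. S k j \<in> jet_terms X" "\<And>k. family_sums (S k) (G k)"
    "family_sums (\<lambda>(k, j). S k j) H"
    by (rule jet_algebra_double_series[OF G]) (rule that)
  have termwise: "family_sums (\<lambda>k. L (T k)) (L F)" if "\<And>k. T k \<in> jet_terms X" "family_sums T F"
    for T :: "nat \<Rightarrow> _" and F
    using L that by (simp add: acts_termwise_def series_sums_iff_family_sums)
  \<comment> \<open>\<open>acts_termwise\<close> concerns sequences only, so the pairs are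
    enumerated here and the enumeration is undone afterwards.\<close>
  have "family_sums (\<lambda>n. L (case prod_decode n of (k, j) \<Rightarrow> S k j)) (L H)"
    by (rule termwise[OF _ family_sums_reindex[OF bij_prod_decode S(3)]]) (simp add: S(1) split: prod.split)
  from family_sums_reindex[OF bij_prod_encode this]
  have "family_sums (\<lambda>(k, j). L (S k j)) (L H)" by (simp add: split_def)
  \<comment> \<open>\<open>L\<close> may spread a term over many degrees, so reducedness of the rows
    need not pass to their images; joint summability of the images takes its place.\<close>
  then show ?thesis
    by (rule family_sums_regroup) (rule termwise[OF S(1,2)])
qed

section \<open>Consequences of the defining conditions of operators\<close>

lemma linear_operator_zero:
  assumes "linear_operator X L"
  shows "L 0 = 0"
proof -
  have "L (0 + 0) = L 0 + L 0"
    using assms jet_algebra_zero[of X] unfolding linear_operator_def by blast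
  then show ?thesis by simp
qed

lemma linear_operator_diff:
  assumes "linear_operator X L" "F \<in> jet_algebra X" "G \<in> jet_algebra X"
  shows "L (F - G) = L F - L G"
proof -
  have "L ((F - G) + G) = L (F - G) + L G"
    using assms jet_algebra_diff[OF assms(2,3)] unfolding linear_operator_def by blast
  then show ?thesis by simp
qed

lemma linear_operatorD:
  assumes "linear_operator X L" "F \<in> jet_algebra X"
  shows "L F \<in> jet_algebra X"
    and "G \<in> jet_algebra X \<Longrightarrow> L (F + G) = L F + L G"
    and "L (series_scale c F) = series_scale c (L F)"
  using assms unfolding linear_operator_def by blast+

lemma characteristic_derivativeD:
  assumes "characteristic_derivative X D Q \<Delta>"
  shows "Q \<in> jet_algebra X" "linear_operator X \<Delta>" "acts_termwise X \<Delta>" "\<Delta> (jet_var X {#}) = Q"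
    and "f \<in> base_functions X \<Longrightarrow> \<Delta> (base_series f) = 0"
    and "F \<in> jet_algebra X \<Longrightarrow> \<Delta> (D i F) = D i (\<Delta> F)"
    and "F \<in> jet_algebra X \<Longrightarrow> G \<in> jet_algebra X \<Longrightarrow> \<Delta> (F \<circledast> G) = \<Delta> F \<circledast> G + F \<circledast> \<Delta> G"
  using assms unfolding characteristic_derivative_def satisfies_Leibniz_def by blast+

lemma characteristic_derivative_lie_bracket:
  fixes \<Delta>\<^sub>1 \<Delta>\<^sub>2 :: "('k::real_normed_field, 'n::finite, 'd) jet_series \<Rightarrow> ('k, 'n, 'd) jet_series"
  assumes D: "total_derivatives X D"
    and d1: "characteristic_derivative X D Q\<^sub>1 \<Delta>\<^sub>1" and d2: "characteristic_derivative X D Q\<^sub>2 \<Delta>\<^sub>2"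
  shows "characteristic_derivative X D (\<Delta>\<^sub>1 Q\<^sub>2 - \<Delta>\<^sub>2 Q\<^sub>1) (lie_bracket \<Delta>\<^sub>1 \<Delta>\<^sub>2)"
proof -
  note lin = characteristic_derivativeD(2)[OF d1] characteristic_derivativeD(2)[OF d2]
  have lin_D: "linear_operator X (D i)" for i
    using D unfolding total_derivatives_def by (elim allE conjE)
  note closed = lin[THEN linear_operatorD(1)] and add = lin[THEN linear_operatorD(2)]
    and scale = lin[THEN linear_operatorD(3)]
  note termwise = characteristic_derivativeD(3)[OF d1] characteristic_derivativeD(3)[OF d2]
  note base = characteristic_derivativeD(5)[OF d1] characteristic_derivativeD(5)[OF d2]
  note comm = characteristic_derivativeD(6)[OF d1] characteristic_derivativeD(6)[OF d2]
  note Leibniz = characteristic_derivativeD(7)[OF d1] characteristic_derivativeD(7)[OF d2]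
  note Q = characteristic_derivativeD(1,4)[OF d1] characteristic_derivativeD(1,4)[OF d2]
  note zero = lin[THEN linear_operator_zero]
  have "linear_operator X (lie_bracket \<Delta>\<^sub>1 \<Delta>\<^sub>2)"
    by (simp add: linear_operator_def lie_bracket_def closed add scale jet_algebra_diff series_scale_diff)
  moreover have "acts_termwise X (lie_bracket \<Delta>\<^sub>1 \<Delta>\<^sub>2)"
    unfolding acts_termwise_def series_sums_iff_family_sums lie_bracket_def
  proof (intro allI impI, elim conjE)
    fix T :: "nat \<Rightarrow> ('k, 'n, 'd) jet_series" and F
    assume T: "\<forall>k. T k \<in> jet_terms X" "family_sums T F"
    then have alg: "T k \<in> jet_algebra X" for k by (simp add: jet_terms_in_algebra)
    \<comment> \<open>The inner derivative turns the terms \<open>T k\<close> into elements of the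
      algebra that still sum to the image of \<open>F\<close>; the outer one then acts on this new
      family.\<close>
    show "family_sums (\<lambda>k. \<Delta>\<^sub>1 (\<Delta>\<^sub>2 (T k)) - \<Delta>\<^sub>2 (\<Delta>\<^sub>1 (T k))) (\<Delta>\<^sub>1 (\<Delta>\<^sub>2 F) - \<Delta>\<^sub>2 (\<Delta>\<^sub>1 F))"
      by (rule family_sums_diff
          [OF acts_termwise_algebra[OF termwise(1) closed(2)[OF alg] acts_termwise_algebra[OF termwise(2) alg T(2)]]
            acts_termwise_algebra[OF termwise(2) closed(1)[OF alg] acts_termwise_algebra[OF termwise(1) alg T(2)]]])
  qed
  moreover have "satisfies_Leibniz X (lie_bracket \<Delta>\<^sub>1 \<Delta>\<^sub>2)"
    by (simp add: satisfies_Leibniz_def lie_bracket_def Leibniz closed add jet_algebra_mult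
        series_mult_diff_left series_mult_diff_right)
  \<comment> \<open>Both derivatives pass \<open>D i\<close> in turn, as each preserves the algebra;
    linearity of \<open>D i\<close> then collects the difference.\<close>
  moreover have "lie_bracket \<Delta>\<^sub>1 \<Delta>\<^sub>2 (D i F) = D i (lie_bracket \<Delta>\<^sub>1 \<Delta>\<^sub>2 F)" if "F \<in> jet_algebra X" for i F
    using that by (simp add: lie_bracket_def comm closed linear_operatorD(1)[OF lin_D] linear_operator_diff[OF lin_D])
  moreover have "\<Delta>\<^sub>1 Q\<^sub>2 - \<Delta>\<^sub>2 Q\<^sub>1 \<in> jet_algebra X"
    by (intro jet_algebra_diff closed Q)
  moreover have "lie_bracket \<Delta>\<^sub>1 \<Delta>\<^sub>2 (base_series f) = 0" if "f \<in> base_functions X" for f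
    using that by (simp add: lie_bracket_def base zero)
  moreover have "lie_bracket \<Delta>\<^sub>1 \<Delta>\<^sub>2 (jet_var X {#}) = \<Delta>\<^sub>1 Q\<^sub>2 - \<Delta>\<^sub>2 Q\<^sub>1"
    by (simp add: lie_bracket_def Q)
  ultimately show ?thesis
    unfolding characteristic_derivative_def by (intro conjI ballI allI)
qed

text \<open>This justifies speaking of the characteristic derivative with a given
  characteristic.\<close>

lemma characteristic_derivative_unique:
  assumes X: "open X" and D: "total_derivatives X D"
    and d1: "characteristic_derivative X D Q \<Delta>" and d2: "characteristic_derivative X D Q \<Delta>'"
    and F: "F \<in> jet_algebra X"
  shows "\<Delta> F = \<Delta>' F"
proof -
  have var: "\<Delta> (jet_var X I) = \<Delta>' (jet_var X I)" for I
  proof (induction I)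
    case empty
    show ?case by (simp add: characteristic_derivativeD(4)[OF d1] characteristic_derivativeD(4)[OF d2])
  next
    case (add i I)
    \<comment> \<open>A further index is a further total derivative, and openness of
      \<open>X\<close> places the variable in the algebra, where commutation with \<open>D i\<close>
      is available.\<close>
    have "jet_var X (add_mset i I) = D i (jet_var X I)"
      using D by (simp add: total_derivatives_def)
    then show ?case
      using add by (simp add: jet_var_in_algebra[OF X] characteristic_derivativeD(6)[OF d1]
          characteristic_derivativeD(6)[OF d2])
  qed
  have base_eq: "\<Delta> (base_series f) = \<Delta>' (base_series f)" if "f \<in> base_functions X" for f
    using that by (simp add: characteristic_derivativeD(5)[OF d1] characteristic_derivativeD(5)[OF d2])
  have mult: "\<Delta> (G \<circledast> H) = \<Delta>' (G \<circledast> H)"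
    if "\<Delta> G = \<Delta>' G" "\<Delta> H = \<Delta>' H" "G \<in> jet_algebra X" "H \<in> jet_algebra X" for G H
    using that by (simp add: characteristic_derivativeD(7)[OF d1] characteristic_derivativeD(7)[OF d2])
  have "\<Delta> P = \<Delta>' P" if "P \<in> jet_terms X" for P
    using that
  proof (induction rule: jet_terms.induct)
    case (base f)
    then show ?case by (rule base_eq)
  next
    case (step f P I)
    then show ?case
      by (intro mult base_eq var jet_algebra_mult jet_var_in_algebra[OF X] jet_terms_in_algebra jet_terms.base)
  qed
  moreover obtain T where T: "\<forall>k. T k \<in> jet_terms X" "series_sums T F"
    using F unfolding jet_algebra_def by blast
  moreover have "family_sums (\<lambda>k. \<Delta> (T k)) (\<Delta> F)" "family_sums (\<lambda>k. \<Delta>' (T k)) (\<Delta>' F)"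
    using characteristic_derivativeD(3)[OF d1] characteristic_derivativeD(3)[OF d2] T
    unfolding acts_termwise_def series_sums_iff_family_sums by blast+
  ultimately show ?thesis by (simp add: family_sums_unique)
qed

text \<open>The second conjunct expresses the operator equation with Delta_Q as agreement on the
  algebra with every operator of that characteristic.\<close>

theorem proposition3:
  fixes X :: "('d \<Rightarrow> real) set"
    and D :: "'d \<Rightarrow> ('k::real_normed_field, 'n::finite, 'd) jet_series \<Rightarrow> ('k, 'n, 'd) jet_series"
    and \<Delta>\<^sub>1 \<Delta>\<^sub>2 :: "('k, 'n, 'd) jet_series \<Rightarrow> ('k, 'n, 'd) jet_series"
    and Q\<^sub>1 Q\<^sub>2 :: "('k, 'n, 'd) jet_series"
  assumes "open X"
    and "total_derivatives X D"
    and "characteristic_derivative X D Q\<^sub>1 \<Delta>\<^sub>1"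
    and "characteristic_derivative X D Q\<^sub>2 \<Delta>\<^sub>2"
  shows "characteristic_derivative X D (\<Delta>\<^sub>1 Q\<^sub>2 - \<Delta>\<^sub>2 Q\<^sub>1) (lie_bracket \<Delta>\<^sub>1 \<Delta>\<^sub>2) \<and>
    (\<forall>\<Delta>. characteristic_derivative X D (\<Delta>\<^sub>1 Q\<^sub>2 - \<Delta>\<^sub>2 Q\<^sub>1) \<Delta> \<longrightarrow>
      (\<forall>F\<in>jet_algebra X. lie_bracket \<Delta>\<^sub>1 \<Delta>\<^sub>2 F = \<Delta> F))"
  using characteristic_derivative_lie_bracket[OF assms(2-4)] characteristic_derivative_unique[OF assms(1,2)]
  by blast

end
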